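(* Let $j^{\operatorname{last}}_{m,k}(321)$ be the number of $321$-avoiding Jacobi permutations $\pi\in\mathfrak{S}_m$ whose last letter equals $k$. For all $n\geq1$, \[ j^{\operatorname{last}}_{2n,k}(321)=\begin{cases}\dfrac{2n-k}{n}\dbinom{k-1}{n-1}, & \text{if } n\leq k\leq 2n-1,\\ 0, & \text{otherwise},\end{cases} \] and \[ j^{\operatorname{last}}_{2n+1,k}(321)=\begin{cases}\dfrac{2n-k+1}{n}\dbinom{k-2}{n-1}, & \text{if } n+1\leq k\leq 2n,\\ 0, & \text{otherwise}.\end{cases} \]
   Context: A permutation of a finite set $S$ of positive integers is a word in which each element of $S$ appears exactly once; $\mathfrak{S}_m$ is the set of permutations of $\{1,\dots,m\}$. For a permutation $\pi$ and a letter $x$ of $\pi$, $\rho_\pi(x)$ is the maximal consecutive subword of $\pi$ consisting of the letters immediately to the right of $x$ that are all larger than $x$. $\pi$ is Jacobi if $|\rho_\pi(x)|$ is even for all letters $x$. A permutation $\pi$ avoids a pattern $\sigma$ if no subword of $\pi$ has standardization (relative order) $\sigma$. *)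

theory Defs
  imports Complex_Main "HOL-Library.Sublist" "HOL-Combinatorics.Multiset_Permutations"
begin

text \<open>Permutations of a finite set are words, i.e. elements of \<^const>\<open>permutations_of_set\<close>.\<close>

text \<open>The word \<open>\<rho>\<^sub>\<pi>(x)\<close>, for a letter \<open>x\<close> of a word \<open>\<pi>\<close> with distinct letters:
  the \<open>tl\<close> drops the occurrence of \<open>x\<close> itself.\<close>
definition rho :: "nat list \<Rightarrow> nat \<Rightarrow> nat list" where
  "rho \<pi> x = takeWhile (\<lambda>y. x < y) (tl (dropWhile (\<lambda>y. y \<noteq> x) \<pi>))"

definition jacobi :: "nat list \<Rightarrow> bool" where
  "jacobi \<pi> \<longleftrightarrow> (\<forall>x \<in> set \<pi>. even (length (rho \<pi> x)))"

text \<open>For words with distinct letters: each letter is replaced by its rank, starting from 1.\<close>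
definition standardization :: "nat list \<Rightarrow> nat list" where
  "standardization w = map (\<lambda>x. card {y \<in> set w. y \<le> x}) w"

text \<open>Subwords in the sense of pattern containment need not be consecutive.\<close>
definition avoids :: "nat list \<Rightarrow> nat list \<Rightarrow> bool" where
  "avoids \<pi> \<sigma> \<longleftrightarrow> \<not> (\<exists>w. subseq w \<pi> \<and> standardization w = \<sigma>)"

definition jlast :: "nat \<Rightarrow> nat \<Rightarrow> nat list \<Rightarrow> nat" where
  "jlast m k \<sigma> =
     card {\<pi> \<in> permutations_of_set {1..m}. jacobi \<pi> \<and> avoids \<pi> \<sigma> \<and> last \<pi> = k}"

end

theory Submission
  imports Defs
begin

text \<open>In a 321-avoiding Jacobi permutation the letters before 1 increase, and the Jacobi condition
  then allows at most one of them. By parity, a permutation of odd length is 1 followed by one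
  of even length, and a permutation of even length has the form \<open>a 1 B\<close> with \<open>B\<close> again
  321-avoiding Jacobi. If the standardization \<open>B'\<close> of \<open>B\<close> has first letter \<open>b\<close>, the possible \<open>a\<close>
  are \<open>2, \<dots>, b + 1\<close>, so these permutations form the Catalan generating tree labelled by first
  letters. The last letter goes up by 2 at every step, except along the single branch on
  which \<open>a = b + 1\<close> has been chosen throughout; hence it records when that branch was left, and the
  number of permutations with last letter \<open>k\<close> is the size of a level of a subtree, a ballot
  number.\<close>

section \<open>321-avoidance and the Jacobi property by recursion on words\<close>

text \<open>This is the condition that \<open>a\<close> in front of \<open>w\<close> is not the 3 of
  a 321. The threshold \<open>a\<close> need not be a letter of \<open>w\<close>, so it can be
  adjusted under relabelling.\<close>

definition inc_below :: "nat \<Rightarrow> nat list \<Rightarrow> bool" where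
  "inc_below a w \<longleftrightarrow> (\<forall>y z. subseq [y, z] w \<longrightarrow> y < a \<longrightarrow> y \<le> z)"

lemma subseq_pair_Cons:
  "subseq [y, z] (v # w) \<longleftrightarrow> subseq [y, z] w \<or> y = v \<and> z \<in> set w"
  by (metis subseq_Cons' subseq_Cons2_iff subseq_singleton_left)

lemma inc_below_Nil [simp]: "inc_below a []"
  by (simp add: inc_below_def)

lemma inc_below_Cons [simp]:
  "inc_below a (v # w) \<longleftrightarrow> inc_below a w \<and> (v < a \<longrightarrow> (\<forall>z\<in>set w. v \<le> z))"
  unfolding inc_below_def subseq_pair_Cons by blast

lemma inc_below_mono: "inc_below b w \<Longrightarrow> a \<le> b \<Longrightarrow> inc_below a w"
  by (auto simp: inc_below_def)

primrec avoids321 :: "nat list \<Rightarrow> bool" where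
  "avoids321 [] \<longleftrightarrow> True"
| "avoids321 (a # w) \<longleftrightarrow> avoids321 w \<and> inc_below a w"

lemma avoids321_iff_subseq:
  "avoids321 w \<longleftrightarrow> (\<forall>x y z. subseq [x, y, z] w \<longrightarrow> y < x \<longrightarrow> y \<le> z)"
proof (induction w)
  case (Cons a w)
  have "subseq [x, y, z] (a # w) \<longleftrightarrow> subseq [x, y, z] w \<or> x = a \<and> subseq [y, z] w" for x y z
    by (auto elim: subseq_Cons')
  then show ?case
    unfolding avoids321.simps inc_below_def Cons.IH by blast
qed simp

lemma standardization_eq_321_iff:
  "standardization w = [3, 2, 1] \<longleftrightarrow> (\<exists>x y z. w = [x, y, z] \<and> z < y \<and> y < x)"
proof
  assume std: "standardization w = [3, 2, 1]"
  then have "length w = 3"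
    by (metis length_map standardization_def length_Cons list.size(3) numeral_3_eq_3)
  then obtain x y z where w: "w = [x, y, z]"
    by (auto simp: numeral_3_eq_3 length_Suc_conv)
  \<comment> \<open>\<open>c v\<close> is the rank of \<open>v\<close>. Ranks are monotone in the
    letter, so ranks 3, 2, 1 force a decreasing word.\<close>
  define c where "c v = card {u \<in> {x, y, z}. u \<le> v}" for v
  have c: "c x = 3" "c y = 2" "c z = 1"
    using std by (simp_all add: standardization_def w c_def)
  have mono: "c u \<le> c v" if "u \<le> v" for u v
    unfolding c_def by (rule card_mono) (use that in auto)
  have "z < y" "y < x"
    using c mono[of y z] mono[of x y] by (force simp: not_le[symmetric])+
  then show "\<exists>x y z. w = [x, y, z] \<and> z < y \<and> y < x"
    using w by blast
next
  assume "\<exists>x y z. w = [x, y, z] \<and> z < y \<and> y < x"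
  then obtain x y z where w: "w = [x, y, z]" "z < y" "y < x"
    by blast
  then have "{u. (u = x \<or> u = y \<or> u = z) \<and> u \<le> x} = {x, y, z}"
    "{u. (u = x \<or> u = y \<or> u = z) \<and> u \<le> y} = {y, z}"
    "{u. (u = x \<or> u = y \<or> u = z) \<and> u \<le> z} = {z}"
    by auto
  then show "standardization w = [3, 2, 1]"
    using w by (simp add: standardization_def)
qed

lemma avoids_321_iff: "avoids w [3, 2, 1] \<longleftrightarrow> avoids321 w"
  unfolding avoids_def avoids321_iff_subseq standardization_eq_321_iff
  by (metis not_le)

lemma jacobi_Nil [simp]: "jacobi []"
  by (simp add: jacobi_def)

text \<open>A new first letter leaves \<open>rho\<close> at the other letters unchanged.\<close>

lemma jacobi_Cons:
  assumes "a \<notin> set w"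
  shows "jacobi (a # w) \<longleftrightarrow> even (length (takeWhile (\<lambda>y. a < y) w)) \<and> jacobi w"
proof -
  have "rho (a # w) a = takeWhile (\<lambda>y. a < y) w" "\<And>x. x \<noteq> a \<Longrightarrow> rho (a # w) x = rho w x"
    by (auto simp: rho_def)
  then show ?thesis
    using assms unfolding jacobi_def by (metis list.set_intros set_ConsD)
qed

lemma jacobi_appendD:
  "distinct (u @ w) \<Longrightarrow> jacobi (u @ w) \<Longrightarrow> jacobi w"
  by (induction u) (auto simp: jacobi_Cons)

lemma avoids321_appendD: "avoids321 (u @ w) \<Longrightarrow> avoids321 w"
  by (induction u) auto

section \<open>Invariance under strictly increasing relabelling\<close>

lemma jacobi_map:
  assumes "strict_mono f" and "distinct w"
  shows "jacobi (map f w) \<longleftrightarrow> jacobi w"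
  using assms(2)
proof (induction w)
  case (Cons a w)
  have "f a \<notin> set (map f w)"
    using Cons.prems by (auto simp: strict_mono_eq[OF assms(1)])
  moreover have "takeWhile (\<lambda>y. f a < y) (map f w) = map f (takeWhile (\<lambda>y. a < y) w)"
    by (simp add: takeWhile_map comp_def strict_mono_less[OF assms(1)])
  ultimately show ?case
    using Cons by (simp add: jacobi_Cons)
qed simp

text \<open>The threshold \<open>b\<close> need not be a value of \<open>f\<close>: later it is the
  letter \<open>a\<close> that \<open>shift a\<close> omits.\<close>

lemma inc_below_map:
  assumes "strict_mono f" and "\<And>v. v \<in> set w \<Longrightarrow> f v < b \<longleftrightarrow> v < a"
  shows "inc_below b (map f w) \<longleftrightarrow> inc_below a w"
  using assms(2) by (induction w) (auto simp: strict_mono_less_eq[OF assms(1)])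

lemma avoids321_map:
  assumes "strict_mono f"
  shows "avoids321 (map f w) \<longleftrightarrow> avoids321 w"
  by (induction w) (simp_all add: inc_below_map[OF assms] strict_mono_less[OF assms])

section \<open>The generating tree\<close>

definition jac321 :: "nat \<Rightarrow> nat list set" where
  "jac321 m = {w \<in> permutations_of_set {1..m}. jacobi w \<and> avoids321 w}"

lemma jlast_321_eq: "jlast m k [3, 2, 1] = card {w \<in> jac321 m. last w = k}"
  unfolding jlast_def jac321_def avoids_321_iff by (rule arg_cong[where f = card]) auto

lemma jac321_iff:
  "w \<in> jac321 m \<longleftrightarrow> distinct w \<and> set w = {1..m} \<and> jacobi w \<and> avoids321 w"
  by (auto simp: jac321_def permutations_of_set_def)

lemma finite_jac321 [simp]: "finite (jac321 m)"
  by (simp add: jac321_def)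

lemma length_jac321: "w \<in> jac321 m \<Longrightarrow> length w = m"
  by (metis jac321_iff distinct_card card_atLeastAtMost diff_Suc_1)

section \<open>The position of the letter 1\<close>

lemma takeWhile_gt_min: "\<forall>v\<in>set w. a < v \<Longrightarrow> takeWhile (\<lambda>y. (a::nat) < y) w = w"
  by (simp add: takeWhile_eq_all_conv)

text \<open>If \<open>x\<close>, \<open>y\<close> stand just before 1, avoiding 321 forces
  \<open>x < y\<close>, but then \<open>rho\<close> at \<open>x\<close> is the single letter
  \<open>y\<close>, of odd length. The cases are named after the parity of \<open>m\<close>.\<close>

lemma jac321_split_at_1:
  assumes "w \<in> jac321 m" and "m \<ge> 1"
  obtains (odd) u where "w = 1 # u" "even (length u)"
  | (even) a u where "w = a # 1 # u" "even (length u)"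
proof -
  note w = assms(1)[unfolded jac321_iff]
  then obtain A u where Au: "w = A @ 1 # u"
    using assms(2) by (metis split_list atLeastAtMost_iff order_refl)
  have gt: "v > 1" if "v \<in> set A \<union> set u" for v
  proof -
    have "v \<in> {1..m}" "v \<noteq> 1"
      using w that unfolding Au by auto
    then show ?thesis by simp
  qed
  \<comment> \<open>All letters after 1 exceed it, so \<open>rho\<close> at 1 is all of
    \<open>u\<close>.\<close>
  have "jacobi (1 # u)"
    using w jacobi_appendD unfolding Au by blast
  then have even_u: "even (length u)"
    using w gt unfolding Au by (simp add: jacobi_Cons takeWhile_gt_min)
  have "length A \<le> 1"
  proof (rule ccontr)
    assume "\<not> length A \<le> 1"
    then obtain y A' where 1: "A = A' @ [y]" "A' \<noteq> []"
      by (cases A rule: rev_cases) auto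
    then obtain x C where A: "A = C @ [x, y]"
      by (cases A' rule: rev_cases) auto
    have w': "w = C @ (x # y # 1 # u)"
      by (simp add: Au A)
    have "jacobi (x # y # 1 # u)" "avoids321 (x # y # 1 # u)"
      using w jacobi_appendD avoids321_appendD unfolding w' by blast+
    moreover have "x > 1" "y > 1" "x \<noteq> y" "distinct (x # y # 1 # u)"
      using gt[of x] gt[of y] w unfolding w' by (auto simp: A)
    ultimately show False
      by (auto simp: jacobi_Cons not_less split: if_splits)
  qed
  then consider "A = []" | a where "A = [a]"
    by (cases A) auto
  then show thesis
    using that Au even_u by cases auto
qed

text \<open>The order isomorphism from the positive integers onto those other than 1 and \<open>a\<close>
  (for \<open>a \<ge> 2\<close>).\<close>

definition shift :: "nat \<Rightarrow> nat \<Rightarrow> nat" where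
  "shift a v = (if v + 1 < a then v + 1 else v + 2)"

lemma strict_mono_shift: "strict_mono (shift a)"
  by (auto simp: strict_mono_def shift_def)

lemma shift_image:
  assumes "2 \<le> a" "a \<le> m + 2"
  shows "shift a ` {1..m} = {1..m + 2} - {1, a}"
proof
  show "shift a ` {1..m} \<subseteq> {1..m + 2} - {1, a}"
    by (auto simp: shift_def)
  show "{1..m + 2} - {1, a} \<subseteq> shift a ` {1..m}"
  proof
    fix v assume v: "v \<in> {1..m + 2} - {1, a}"
    show "v \<in> shift a ` {1..m}"
    proof (cases "v < a")
      case True
      then show ?thesis using v assms
        by (intro image_eqI[of _ _ "v - 1"]) (auto simp: shift_def)
    next
      case False
      then show ?thesis using v assms
        by (intro image_eqI[of _ _ "v - 2"]) (auto simp: shift_def)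
    qed
  qed
qed

definition extend :: "nat list \<times> nat \<Rightarrow> nat list" where
  "extend = (\<lambda>(w, a). a # 1 # map (shift a) w)"

lemma inj_extend: "inj extend"
proof -
  have "inj (shift a)" for a
    by (rule strict_mono_imp_inj_on[OF strict_mono_shift])
  then show ?thesis
    by (intro injI) (auto simp: extend_def inj_map_eq_map)
qed

text \<open>In \<open>a # 1 # u\<close>, \<open>rho\<close> at \<open>a\<close> is empty and at 1 it
  is all of \<open>u\<close>, of even length \<open>m\<close>. The only new condition is that
  \<open>a\<close> starts no 321; \<open>shift a\<close> adds 1 to the letters it sends below
  \<open>a\<close>, so the threshold for \<open>w\<close> is \<open>a - 1\<close>.\<close>

lemma extend_mem_jac321_iff:
  assumes "even m" "distinct w" "set w = {1..m}" "2 \<le> a" "a \<le> m + 2"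
  shows "extend (w, a) \<in> jac321 (m + 2) \<longleftrightarrow> w \<in> jac321 m \<and> inc_below (a - 1) w"
proof -
  let ?u = "map (shift a) w"
  have set_u: "set ?u = {1..m + 2} - {1, a}"
    using shift_image[OF assms(4,5)] assms(3) by simp
  have distinct: "distinct ?u"
    using assms(2) strict_mono_shift by (simp add: distinct_map strict_mono_imp_inj_on)
  have len: "length w = m"
    using distinct_card[OF assms(2)] assms(3) by simp
  have gt: "\<forall>v\<in>set ?u. 1 < v"
    using set_u by auto
  have "1 \<notin> set ?u" "a \<notin> set (1 # ?u)"
    using set_u assms(4) by auto
  then have "jacobi (a # 1 # ?u) \<longleftrightarrow> jacobi w"
    using assms(1,2,4) gt
    by (simp add: jacobi_Cons takeWhile_gt_min len jacobi_map strict_mono_shift del: set_map)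
  moreover have "inc_below 1 ?u"
    using gt by (auto simp: inc_below_def)
  moreover have "inc_below a ?u \<longleftrightarrow> inc_below (a - 1) w"
    by (rule inc_below_map[OF strict_mono_shift]) (auto simp: shift_def)
  moreover have "set (a # 1 # ?u) = {1..m + 2}"
    using assms(4,5) unfolding list.set(2) set_u by auto
  moreover have "distinct (a # 1 # ?u)"
    using \<open>1 \<notin> set ?u\<close> \<open>a \<notin> set (1 # ?u)\<close> distinct by simp
  moreover have "\<forall>z\<in>set ?u. 1 \<le> z"
    using gt by auto
  ultimately show ?thesis
    using assms(2,3)
    by (auto simp: jac321_iff extend_def avoids321_map strict_mono_shift simp del: set_map)
qed

lemma jac321_add_2:
  assumes "even m"
  shows "jac321 (m + 2) =
    extend ` (SIGMA w : jac321 m. {a. 2 \<le> a \<and> a \<le> m + 2 \<and> inc_below (a - 1) w})"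
    (is "_ = extend ` ?S")
proof
  show "extend ` ?S \<subseteq> jac321 (m + 2)"
    using extend_mem_jac321_iff[OF assms] by (fastforce simp: jac321_iff)
  show "jac321 (m + 2) \<subseteq> extend ` ?S"
  proof
    fix w assume w: "w \<in> jac321 (m + 2)"
    then have len: "length w = m + 2"
      by (rule length_jac321)
    obtain a u where au: "w = a # 1 # u"
      using len assms by (cases rule: jac321_split_at_1[OF w]) auto
    have a: "2 \<le> a" "a \<le> m + 2" and u: "distinct u" "set u = {1..m + 2} - {1, a}"
    proof -
      have "a \<in> {1..m + 2}" "a \<noteq> 1"
        using w unfolding au jac321_iff by auto
      then show "2 \<le> a" "a \<le> m + 2" by auto
      show "distinct u" "set u = {1..m + 2} - {1, a}"
        using w unfolding au jac321_iff by auto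
    qed
    \<comment> \<open>The letters of \<open>u\<close> lie in the range of \<open>shift a\<close>, so
      they are recovered from their inverse images.\<close>
    define v where "v = map (inv (shift a)) u"
    have uv: "u = map (shift a) v"
    proof -
      have "shift a (inv (shift a) x) = x" if "x \<in> set u" for x
        using that f_inv_into_f[of x "shift a" UNIV] shift_image[OF a] u by blast
      then show ?thesis
        by (simp add: v_def map_idI)
    qed
    have inj: "inj (shift a)"
      by (simp add: strict_mono_imp_inj_on strict_mono_shift)
    have "shift a ` set v = shift a ` {1..m}"
      using shift_image[OF a] u uv by simp
    then have "set v = {1..m}"
      using inj by (simp add: inj_image_eq_iff)
    moreover have "distinct v"
      using u(1) unfolding uv by (simp add: distinct_map)
    moreover have "extend (v, a) = w"
      by (simp add: extend_def au uv)
    ultimately have "(v, a) \<in> ?S"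
      using extend_mem_jac321_iff[OF assms, of v a] a w by auto
    then show "w \<in> extend ` ?S"
      by (rule rev_image_eqI) (simp add: \<open>extend (v, a) = w\<close>)
  qed
qed

lemma jac321_even_Cons_Cons:
  assumes "w \<in> jac321 m" "even m" "m \<ge> 1"
  obtains b u where "w = b # 1 # u" "2 \<le> b" "b \<le> m"
proof -
  obtain m' where "m = m' + 2" "even m'"
    using assms(2,3) that by (intro that[of "m - 2"]) presburger+
  then show ?thesis
    using assms(1) jac321_add_2[of m'] that by (auto simp: extend_def)
qed

text \<open>Let \<open>w = b # 1 # u\<close>. Avoidance by \<open>w\<close> already gives the
  condition for \<open>a - 1 \<le> b\<close>; for \<open>a - 1 > b\<close> it fails at the pair
  \<open>b\<close>, 1. The tree is rooted at \<open>n = 1\<close>, since the empty word has no first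
  letter.\<close>

lemma jac321_even_step:
  assumes "n \<ge> 1"
  shows "jac321 (2 * Suc n) = extend ` (SIGMA w : jac321 (2 * n). {2..hd w + 1})"
proof -
  have "{a. 2 \<le> a \<and> a \<le> 2 * n + 2 \<and> inc_below (a - 1) w} = {2..hd w + 1}"
    if w: "w \<in> jac321 (2 * n)" for w
  proof -
    obtain b u where b: "w = b # 1 # u" "2 \<le> b" "b \<le> 2 * n"
      using jac321_even_Cons_Cons[OF w] assms by auto
    have "avoids321 w"
      using w by (simp add: jac321_iff)
    then have "inc_below b (1 # u)"
      unfolding b by simp
    then have "inc_below (a - 1) (1 # u)" if "a \<le> b + 1" for a
      using that by (auto elim: inc_below_mono simp del: inc_below_Cons)
    then have "inc_below (a - 1) w \<longleftrightarrow> a \<le> b + 1" if "2 \<le> a" for a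
      using b that by (fastforce simp: b(1))
    moreover have "hd w = b"
      by (simp add: b)
    ultimately show ?thesis
      using b(2,3) by auto
  qed
  then have "(SIGMA w : jac321 (2 * n). {a. 2 \<le> a \<and> a \<le> 2 * n + 2 \<and> inc_below (a - 1) w})
      = (SIGMA w : jac321 (2 * n). {2..hd w + 1})"
    by (intro Sigma_cong) auto
  then show ?thesis
    using jac321_add_2[of "2 * n"] by simp
qed

section \<open>Small cases and odd length\<close>

lemma jac321_0: "jac321 0 = {[]}"
  by (auto simp: jac321_iff)

lemma jac321_2: "jac321 2 = {[2, 1]}"
proof -
  have "(SIGMA w : {[]}. {a. 2 \<le> a \<and> a \<le> 0 + 2 \<and> inc_below (a - 1) w}) = {([], 2)}"
    by auto
  then show ?thesis
    using jac321_add_2[of 0] by (simp add: jac321_0 extend_def flip: numeral_2_eq_2)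
qed

text \<open>Odd length forces 1 to come first. There it starts no 321, and \<open>rho\<close> at 1
  is the whole rest, of even length.\<close>

lemma jac321_odd: "jac321 (2 * n + 1) = (\<lambda>w. 1 # map Suc w) ` jac321 (2 * n)"
proof
  have mono: "strict_mono Suc"
    by (simp add: strict_mono_def)
  have mem: "1 # map Suc v \<in> jac321 (2 * n + 1) \<longleftrightarrow> v \<in> jac321 (2 * n)"
    if v: "distinct v" "set v = {1..2 * n}" for v
  proof -
    have "length v = 2 * n"
      using distinct_card[OF v(1)] v(2) by simp
    moreover have "set (1 # map Suc v) = {1..2 * n + 1}"
      using v(2) by (auto simp: image_Suc_atLeastAtMost)
    moreover have "\<forall>x\<in>set (map Suc v). 1 < x"
      using v(2) by auto
    moreover from this have "1 \<notin> set (map Suc v)" "inc_below 1 (map Suc v)"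
      by (auto simp: inc_below_def)
    moreover have "distinct (map Suc v)"
      using v(1) by (simp add: distinct_map)
    ultimately show ?thesis
      using v
      by (simp add: jac321_iff jacobi_Cons takeWhile_gt_min jacobi_map avoids321_map mono
          del: set_map One_nat_def)
  qed
  show "(\<lambda>w. 1 # map Suc w) ` jac321 (2 * n) \<subseteq> jac321 (2 * n + 1)"
    using mem by (auto simp: jac321_iff)
  show "jac321 (2 * n + 1) \<subseteq> (\<lambda>w. 1 # map Suc w) ` jac321 (2 * n)"
  proof
    fix w assume w: "w \<in> jac321 (2 * n + 1)"
    then have len: "length w = 2 * n + 1"
      by (rule length_jac321)
    obtain u where u: "w = 1 # u"
      using len by (cases rule: jac321_split_at_1[OF w]) (auto, presburger)
    have 1: "distinct (1 # u)" "set (1 # u) = {1..2 * n + 1}"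
      using w unfolding u jac321_iff by blast+
    have "set u = set (1 # u) - {1}"
      using 1(1) by auto
    also have "\<dots> = {2..2 * n + 1}"
      unfolding 1(2) by auto
    finally have set_u: "distinct u" "set u = {2..2 * n + 1}"
      using 1(1) by simp_all
    define v where "v = map (\<lambda>x. x - 1) u"
    have uv: "u = map Suc v"
    proof -
      have "map Suc v = u"
        unfolding v_def map_map by (rule map_idI) (use set_u in auto)
      then show ?thesis by (rule sym)
    qed
    have "Suc ` set v = Suc ` {1..2 * n}"
      using set_u unfolding uv by (simp add: image_Suc_atLeastAtMost numeral_2_eq_2)
    then have "set v = {1..2 * n}"
      using inj_image_eq_iff[OF inj_Suc] by blast
    moreover have "distinct v"
      using set_u unfolding uv by (simp add: distinct_map)
    ultimately show "w \<in> (\<lambda>w. 1 # map Suc w) ` jac321 (2 * n)"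
      using mem[of v] w unfolding u uv by blast
  qed
qed

section \<open>Counting by last letter\<close>

text \<open>The number of nodes \<open>r\<close> levels below a node with label \<open>h\<close>.\<close>

fun ballot :: "nat \<Rightarrow> nat \<Rightarrow> nat" where
  "ballot 0 h = 1"
| "ballot (Suc r) h = (\<Sum>a = 2..h + 1. ballot r a)"

lemma ballot_Suc_Suc: "ballot (Suc r) (Suc h) = ballot (Suc r) h + ballot r (h + 2)"
  by simp

text \<open>The recurrence \<open>ballot_Suc_Suc\<close> is Pascal's rule applied to both binomials;
  hence an induction on \<open>h\<close> inside one on \<open>r\<close>.\<close>

lemma ballot_eq:
  "int (ballot (Suc r) h) = int ((2 * r + h + 1) choose Suc r) - int ((2 * r + h + 1) choose r)"
proof (induction r arbitrary: h)
  case 0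
  show ?case by simp
next
  case (Suc r)
  show ?case
  proof (induction h)
    case 0
    \<comment> \<open>At \<open>h = 0\<close> the sum is empty, and the two middle binomials of an
      odd row cancel.\<close>
    have "(2 * r + 3) choose (r + 1) = (2 * r + 3) choose (r + 2)"
      by (subst binomial_symmetric) auto
    then show ?case
      by (simp add: numeral_eq_Suc)
  next
    case (Suc h)
    have "2 * Suc r + Suc h + 1 = Suc (2 * r + h + 3)" "2 * Suc r + h + 1 = 2 * r + h + 3"
      "2 * r + (h + 2) + 1 = 2 * r + h + 3"
      by simp_all
    then show ?case
      using Suc.IH \<open>\<And>h. int (ballot (Suc r) h) = _\<close>[of "h + 2"]
      by (simp only: ballot_Suc_Suc of_nat_add binomial_Suc_Suc)
  qed
qed

section \<open>Last letters along the tree\<close>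

text \<open>The first alternative is the exceptional branch \<open>a = hd v + 1\<close>. Off it
  \<open>last v \<ge> hd v\<close>, so every permitted \<open>a\<close> makes \<open>shift a\<close>
  raise the last letter by 2.\<close>

lemma jac321_hd_last:
  assumes "n \<ge> 1" "w \<in> jac321 (2 * n)"
  shows "w \<noteq> [] \<and> last w < 2 * n \<and>
    (last w = n \<and> hd w = n + 1 \<or> last w > n \<and> last w \<ge> hd w)"
  using assms
proof (induction n arbitrary: w rule: nat_induct_at_least)
  case base
  then show ?case by (simp add: jac321_2)
next
  case (Suc n)
  from Suc.prems obtain v a where v: "v \<in> jac321 (2 * n)" "2 \<le> a" "a \<le> hd v + 1"
    and w: "w = extend (v, a)"
    unfolding jac321_even_step[OF Suc.hyps] by auto
  then have "hd w = a" "last w = shift a (last v)" "w \<noteq> []"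
    using Suc.IH[OF v(1)] by (auto simp: extend_def last_map)
  then show ?case
    using Suc.IH[OF v(1)] v by (auto simp: shift_def)
qed

lemma sum_ballot_children:
  assumes "n \<ge> 1" "w \<in> jac321 (2 * n)"
  shows "(\<Sum>a = 2..hd w + 1. if shift a (last w) = k then ballot r a else 0) =
    (if last w = n
     then (if k = n + 1 then ballot r (n + 2) else if k = n + 2 then ballot (Suc r) n else 0)
     else if last w + 2 = k then ballot (Suc r) (hd w) else 0)"
proof (cases "last w = n")
  case True
  then have "hd w = n + 1"
    using jac321_hd_last[OF assms] by auto
  \<comment> \<open>The remaining child \<open>a = n + 2\<close> stays on the exceptional branch and
    has last letter \<open>n + 1\<close>.\<close>
  have "(\<Sum>a = 2..n + 1. if shift a n = k then ballot r a else 0) =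
      (\<Sum>a = 2..n + 1. if k = n + 2 then ballot r a else 0)"
    by (rule sum.cong) (auto simp: shift_def)
  also have "\<dots> = (if k = n + 2 then ballot (Suc r) n else 0)"
    by simp
  finally show ?thesis
    using True \<open>hd w = n + 1\<close> by (auto simp: shift_def)
next
  case False
  then have "hd w \<le> last w"
    using jac321_hd_last[OF assms] by auto
  then have "(\<Sum>a = 2..hd w + 1. if shift a (last w) = k then ballot r a else 0) =
      (\<Sum>a = 2..hd w + 1. if last w + 2 = k then ballot r a else 0)"
    by (intro sum.cong) (auto simp: shift_def)
  then show ?thesis
    using False by simp
qed

text \<open>Weighting each word by its number of descendants \<open>r\<close> levels down makes the
  induction close. Leaving the exceptional branch at level \<open>j\<close> gives last letter
  \<open>k = 2 * n - j\<close> at level \<open>n\<close>; the children that leave have labels 2 to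
  \<open>j + 1\<close>, like all children of a node labelled \<open>j\<close>, whence the second
  argument of \<open>ballot\<close>.\<close>

lemma sum_ballot_last:
  assumes "n \<ge> 1"
  shows "(\<Sum>w | w \<in> jac321 (2 * n) \<and> last w = k. ballot r (hd w)) =
    (if k = n then ballot r (n + 1)
     else if n < k \<and> k < 2 * n then ballot (r + k - n) (2 * n - k) else 0)"
  using assms
proof (induction n arbitrary: r k rule: nat_induct_at_least)
  case base
  have "{w. w \<in> jac321 2 \<and> last w = k} = (if k = 1 then {[2, 1]} else {})"
    by (auto simp: jac321_2)
  then show ?case by (simp add: numeral_2_eq_2)
next
  case (Suc n)
  let ?J = "jac321 (2 * n)"
  define D where
    "D = (if k = n + 1 then ballot r (n + 2) else if k = n + 2 then ballot (Suc r) n else 0)"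
  \<comment> \<open>With \<open>r = 0\<close> all weights are 1: the exceptional branch has one word
    per level.\<close>
  have one: "card {w \<in> ?J. last w = n} = 1"
    using Suc.IH[of 0 n] by simp
  have "(\<Sum>w | w \<in> jac321 (2 * Suc n) \<and> last w = k. ballot r (hd w)) =
      (\<Sum>w \<in> jac321 (2 * Suc n). if last w = k then ballot r (hd w) else 0)"
    by (simp add: sum.inter_filter)
  also have "\<dots> = (\<Sum>p \<in> (SIGMA w : ?J. {2..hd w + 1}).
      if last (extend p) = k then ballot r (hd (extend p)) else 0)"
    unfolding jac321_even_step[OF Suc.hyps]
    by (subst sum.reindex) (auto intro: inj_on_subset[OF inj_extend])
  also have "\<dots> = (\<Sum>w \<in> ?J. \<Sum>a = 2..hd w + 1.
      if last (extend (w, a)) = k then ballot r (hd (extend (w, a))) else 0)"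
    by (rule sum.Sigma[symmetric, where g = "\<lambda>w a. if last (extend (w, a)) = k
      then ballot r (hd (extend (w, a))) else 0", unfolded case_prod_eta split_beta' prod.collapse])
      simp_all
  also have "\<dots> = (\<Sum>w \<in> ?J. \<Sum>a = 2..hd w + 1. if shift a (last w) = k then ballot r a else 0)"
    using jac321_hd_last[OF Suc.hyps] by (intro sum.cong) (auto simp: extend_def last_map)
  also have "\<dots> = (\<Sum>w \<in> ?J. if last w = n then D
      else if last w + 2 = k then ballot (Suc r) (hd w) else 0)"
    unfolding D_def by (intro sum.cong refl sum_ballot_children[OF Suc.hyps])
  \<comment> \<open>Off the branch \<open>last w > n\<close>, so the guard \<open>n + 2 < k\<close>
    loses nothing; it also separates the two terms and keeps \<open>k - 2\<close> from
    truncating.\<close>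
  also have "\<dots> = (\<Sum>w \<in> ?J. (if last w = n then D else 0) +
      (if last w = k - 2 then if n + 2 < k then ballot (Suc r) (hd w) else 0 else 0))"
    using jac321_hd_last[OF Suc.hyps] by (intro sum.cong) fastforce+
  also have "\<dots> = card {w \<in> ?J. last w = n} * D +
      (\<Sum>w | w \<in> ?J \<and> last w = k - 2. if n + 2 < k then ballot (Suc r) (hd w) else 0)"
    by (simp add: sum.distrib sum.inter_filter[symmetric])
  also have "\<dots> = D + (if n + 2 < k then
      (\<Sum>w | w \<in> ?J \<and> last w = k - 2. ballot (Suc r) (hd w)) else 0)"
    using one by simp
  also have "\<dots> = (if k = Suc n then ballot r (Suc n + 1)
     else if Suc n < k \<and> k < 2 * Suc n then ballot (r + k - Suc n) (2 * Suc n - k) else 0)"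
  proof (cases "n + 2 < k")
    case True
    then have "Suc r + (k - 2) - n = r + k - Suc n" "2 * n - (k - 2) = 2 * Suc n - k"
      "k - 2 < 2 * n \<longleftrightarrow> k < 2 * Suc n" "k - 2 \<noteq> n" "n < k - 2" "D = 0"
      by (auto simp: D_def)
    then show ?thesis
      using True Suc.IH[of "Suc r" "k - 2"] by simp
  next
    case False
    then consider "k \<le> n" | "k = n + 1" | "k = n + 2"
      by linarith
    then show ?thesis
      using Suc.hyps by cases (simp_all add: D_def del: ballot.simps)
  qed
  finally show ?case .
qed

section \<open>Closed forms\<close>

text \<open>By symmetry the lower indices become \<open>n - 1\<close> and \<open>n\<close> in row
  \<open>k - 1\<close>; absorption expresses the second binomial as \<open>(k - n) / n\<close> times
  the first.\<close>

lemma ballot_closed_form: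
  assumes "n \<ge> 1" "n < k" "k < 2 * n"
  shows "real (ballot (k - n) (2 * n - k)) =
    (2 * real n - real k) / real n * real ((k - 1) choose (n - 1))"
proof -
  obtain r where r: "k - n = Suc r"
    using assms(2) by (metis Suc_diff_Suc)
  have top: "2 * r + (2 * n - k) + 1 = k - 1"
    using assms r by linarith
  have "(k - 1) choose Suc r = (k - 1) choose (n - 1)" "(k - 1) choose r = (k - 1) choose n"
  proof -
    have "k - 1 - Suc r = n - 1" "k - 1 - r = n" "Suc r \<le> k - 1" "r \<le> k - 1"
      using assms r by linarith+
    then show "(k - 1) choose Suc r = (k - 1) choose (n - 1)" "(k - 1) choose r = (k - 1) choose n"
      by (metis binomial_symmetric)+
  qed
  then have "int (ballot (k - n) (2 * n - k)) =
      int ((k - 1) choose (n - 1)) - int ((k - 1) choose n)"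
    unfolding r ballot_eq top by simp
  then have ballot: "real (ballot (k - n) (2 * n - k)) =
      real ((k - 1) choose (n - 1)) - real ((k - 1) choose n)"
    by linarith
  have "n * ((k - 1) choose n) = (k - n) * ((k - 1) choose (n - 1))"
    using binomial_absorb_comp[of "k - 1" "n - 1"] binomial_absorption[of "n - 1" "k - 1"] assms
    by simp
  then have "real n * real ((k - 1) choose n) = (real k - real n) * real ((k - 1) choose (n - 1))"
    using assms(2) by (metis of_nat_mult of_nat_diff less_imp_le)
  then show ?thesis
    using assms(1) unfolding ballot by (simp add: field_simps)
qed

lemma jlast_even:
  assumes "n \<ge> 1"
  shows "real (jlast (2 * n) k [3, 2, 1]) =
    (if n \<le> k \<and> k \<le> 2 * n - 1
     then (2 * real n - real k) / real n * real ((k - 1) choose (n - 1)) else 0)"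
proof -
  have "jlast (2 * n) k [3, 2, 1] =
      (if k = n then 1 else if n < k \<and> k < 2 * n then ballot (k - n) (2 * n - k) else 0)"
    using sum_ballot_last[OF assms, of 0 k] by (simp add: jlast_321_eq del: One_nat_def)
  \<comment> \<open>At \<open>k = n\<close> the closed form also equals 1.\<close>
  then show ?thesis
    using assms ballot_closed_form[OF assms, of k] by auto
qed

text \<open>Prefixing 1 raises every letter, hence also the last, by 1; \<open>k = 0\<close> is
  separate because \<open>k - 1\<close> truncates.\<close>

lemma jlast_odd:
  assumes "n \<ge> 1"
  shows "jlast (2 * n + 1) k [3, 2, 1] = (if k = 0 then 0 else jlast (2 * n) (k - 1) [3, 2, 1])"
proof -
  have "{w \<in> jac321 (2 * n + 1). last w = k} =
      (\<lambda>w. 1 # map Suc w) ` {w \<in> jac321 (2 * n). Suc (last w) = k}"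
    unfolding jac321_odd using jac321_hd_last[OF assms] by (auto simp: last_map)
  moreover have "inj_on (\<lambda>w. 1 # map Suc w) A" for A
    by (auto simp: inj_on_def)
  ultimately have "jlast (2 * n + 1) k [3, 2, 1] = card {w \<in> jac321 (2 * n). Suc (last w) = k}"
    by (simp add: jlast_321_eq card_image del: One_nat_def add_Suc_right)
  then show ?thesis
    by (cases k) (simp_all add: jlast_321_eq del: One_nat_def)
qed

theorem theorem7p9:
  fixes n k :: nat
  assumes "n \<ge> 1"
  shows "real (jlast (2 * n) k [3, 2, 1]) =
           (if n \<le> k \<and> k \<le> 2 * n - 1
            then (2 * real n - real k) / real n * real ((k - 1) choose (n - 1))
            else 0)
       \<and> real (jlast (2 * n + 1) k [3, 2, 1]) =
           (if n + 1 \<le> k \<and> k \<le> 2 * n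
            then (2 * real n - real k + 1) / real n * real ((k - 2) choose (n - 1))
            else 0)"
proof
  show "real (jlast (2 * n) k [3, 2, 1]) =
           (if n \<le> k \<and> k \<le> 2 * n - 1
            then (2 * real n - real k) / real n * real ((k - 1) choose (n - 1))
            else 0)"
    by (rule jlast_even[OF assms])
  show "real (jlast (2 * n + 1) k [3, 2, 1]) =
           (if n + 1 \<le> k \<and> k \<le> 2 * n
            then (2 * real n - real k + 1) / real n * real ((k - 2) choose (n - 1))
            else 0)"
  proof (cases k)
    case 0
    then show ?thesis
      unfolding jlast_odd[OF assms] by simp
  next
    case (Suc k')
    have "jlast (2 * n + 1) k [3, 2, 1] = jlast (2 * n) k' [3, 2, 1]"
      unfolding jlast_odd[OF assms] Suc by simp
    moreover have "n + 1 \<le> k \<and> k \<le> 2 * n \<longleftrightarrow> n \<le> k' \<and> k' \<le> 2 * n - 1"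
      using Suc assms by auto
    \<comment> \<open>The second equation survives truncation at \<open>k = 1\<close>, where both
      sides are 0.\<close>
    moreover have "2 * real n - real k + 1 = 2 * real n - real k'" "k - 2 = k' - 1"
      using Suc by auto
    ultimately show ?thesis
      by (simp only: jlast_even[OF assms])
  qed
qed

end
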